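(* Let $R\subseteq T$ be commutative rings with identity, where $R$ is a subring of $T$ containing the identity of $T$, and let $I=(R:T)$. Suppose that the following conditions hold: (1) $R$ is both an associated subring and a locally associated subring of $T$; (2) $I$ is the intersection of finitely many maximal ideals $M_1,\dots,M_n$ of $T$; (3) the ideals $R\cap M_1,\dots,R\cap M_n$ are pairwise comaximal as ideals of $R$. Then $R[[x]]$ is an associated subring of $T[[x]]$.
   Context: $U(A)$ denotes the group of units of a commutative ring $A$ with identity. The conductor is $(R:T)=\{r\in R : rT\subseteq R\}$. Ideals $A,B$ of a ring $R$ are comaximal if $A+B=R$. A subring $R$ of a commutative ring $T$ with identity is an associated subring of $T$ if for every $t\in T$ there exists $u\in U(T)$ such that $tu\in R$ (equivalently $T=R\cdot U(T)$). A subring $R$ (containing the identity) of a commutative ring $T$ with identity, with $I=(R:T)$, is a locally associated subring of $T$ if for every $t\in T$ with $tT+I=T$ there exist $r\in R$ with $rR+I=R$ and $u\in U(T)$ such that $t=ru$. *)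

theory Defs
  imports "HOL-Algebra.Algebra"
begin

definition conductor :: "'a set \<Rightarrow> ('a, 'm) ring_scheme \<Rightarrow> 'a set" where
  "conductor R T = {r \<in> R. \<forall>t \<in> carrier T. r \<otimes>\<^bsub>T\<^esub> t \<in> R}"

definition comaximal :: "('a, 'm) ring_scheme \<Rightarrow> 'a set \<Rightarrow> 'a set \<Rightarrow> bool" where
  "comaximal S A B \<longleftrightarrow> A <+>\<^bsub>S\<^esub> B = carrier S"

definition associated_subring :: "'a set \<Rightarrow> ('a, 'm) ring_scheme \<Rightarrow> bool" where
  "associated_subring R T \<longleftrightarrow>
     subring R T \<and> (\<forall>t \<in> carrier T. \<exists>u \<in> Units T. t \<otimes>\<^bsub>T\<^esub> u \<in> R)"

(* The principal ideal rR has to be formed in the subring R, not in T. *)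
definition locally_associated_subring :: "'a set \<Rightarrow> ('a, 'm) ring_scheme \<Rightarrow> bool" where
  "locally_associated_subring R T \<longleftrightarrow>
     subring R T \<and>
     (\<forall>t \<in> carrier T. comaximal T (PIdl\<^bsub>T\<^esub> t) (conductor R T) \<longrightarrow>
        (\<exists>r \<in> R. \<exists>u \<in> Units T.
           comaximal (T\<lparr>carrier := R\<rparr>) (PIdl\<^bsub>T\<lparr>carrier := R\<rparr>\<^esub> r) (conductor R T) \<and>
           t = r \<otimes>\<^bsub>T\<^esub> u))"

(* A formal power series is identified with its coefficient sequence; multiplication is the
   Cauchy product. The library type of formal power series only covers coefficient rings given
   by a whole type, whereas here the coefficient ring is an arbitrary carrier set. *)
definition power_series_ring :: "('a, 'm) ring_scheme \<Rightarrow> (nat \<Rightarrow> 'a) ring" where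
  "power_series_ring A =
     \<lparr>carrier = UNIV \<rightarrow> carrier A,
      monoid.mult = (\<lambda>f g n. \<Oplus>\<^bsub>A\<^esub>i \<in> {..n}. f i \<otimes>\<^bsub>A\<^esub> g (n - i)),
      monoid.one = (\<lambda>n. if n = 0 then \<one>\<^bsub>A\<^esub> else \<zero>\<^bsub>A\<^esub>),
      ring.zero = (\<lambda>n. \<zero>\<^bsub>A\<^esub>),
      ring.add = (\<lambda>f g n. f n \<oplus>\<^bsub>A\<^esub> g n)\<rparr>"

end

theory Submission
  imports Defs
begin

text \<open>
  Over a field every power series is zero or a unit times a power of \<open>x\<close>. Given \<open>f \<in> T[[x]]\<close>,
  this can be used modulo each \<open>M\<^sub>i\<close>: some \<open>h\<^sub>i \<in> T[[x]]\<close>, with \<open>h\<^sub>i(0)\<close> invertible modulo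
  \<open>M\<^sub>i\<close>, makes \<open>f h\<^sub>i\<close> congruent modulo \<open>M\<^sub>i\<close> to \<open>0\<close> or to a power of \<open>x\<close>, a series with
  coefficients in \<open>{0, 1} \<subseteq> R\<close> (\<open>power_series_monomial_mod\<close>).

  Comaximality of the \<open>R \<inter> M\<^sub>i\<close> inside \<open>R\<close> puts Chinese remainder idempotents modulo \<open>I\<close> into \<open>R\<close>
  itself: there are \<open>e\<^sub>i \<in> R\<close> with \<open>e\<^sub>i \<equiv> 1\<close> modulo \<open>M\<^sub>i\<close> and \<open>e\<^sub>i \<in> M\<^sub>j\<close> for \<open>j \<noteq> i\<close>
  (\<open>ex_indicator_mod_ideals\<close>). Put \<open>h = \<Sum> e\<^sub>i h\<^sub>i\<close>. Since \<open>e\<^sub>i M\<^sub>i \<subseteq> I \<subseteq> R\<close>, every coefficient of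
  \<open>f h = \<Sum> e\<^sub>i (f h\<^sub>i)\<close> lies in \<open>R\<close>, and \<open>h(0)\<close> is invertible modulo \<open>I\<close>
  (\<open>ex_power_series_multiplier\<close>).

  The series \<open>h\<close> need not be a unit of \<open>T[[x]]\<close>, because \<open>h(0)\<close> is only a unit modulo \<open>I\<close>. Local
  associatedness repairs this: it gives \<open>h(0) = r u\<close> with \<open>u\<close> a unit of \<open>T\<close> and \<open>1 = s r + m\<close>
  where \<open>s \<in> R\<close> and \<open>m \<in> I\<close>. The series \<open>v = s h + m u\<close> has constant term \<open>(s r + m) u = u\<close>, hence
  is a unit (\<open>power_series_Units\<close>), and \<open>f v = s (f h) + m (u f)\<close> still has coefficients in
  \<open>R\<close> because \<open>m T \<subseteq> R\<close>.
\<close>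

section \<open>Finite sums and congruences modulo an ideal\<close>

lemma (in abelian_monoid) finsum_mem_of_add_closed:
  assumes "\<zero> \<in> S" and "S \<subseteq> carrier G"
    and add: "\<And>x y. x \<in> S \<Longrightarrow> y \<in> S \<Longrightarrow> x \<oplus> y \<in> S"
    and "f \<in> A \<rightarrow> S"
  shows "finsum G f A \<in> S"
proof (cases "finite A")
  case True
  then show ?thesis using \<open>f \<in> A \<rightarrow> S\<close>
  proof (induction A)
    case empty
    then show ?case using assms(1) by simp
  next
    case (insert a A)
    have "f \<in> A \<rightarrow> carrier G" "f a \<in> carrier G"
      using insert.prems assms(2) by auto
    then show ?case using insert add by simp
  qed
qed (use assms(1) in \<open>simp add: finsum_infinite\<close>)

lemma (in ideal) finsum_cong_mod:
  assumes "finite A" and "f \<in> A \<rightarrow> carrier R" and "g \<in> A \<rightarrow> carrier R"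
    and "\<And>i. i \<in> A \<Longrightarrow> f i \<ominus> g i \<in> I"
  shows "finsum R f A \<ominus> finsum R g A \<in> I"
  using assms
proof (induction A)
  case empty
  then show ?case by (simp add: a_minus_def)
next
  case (insert a A)
  have c: "f a \<in> carrier R" "g a \<in> carrier R" "f \<in> A \<rightarrow> carrier R" "g \<in> A \<rightarrow> carrier R"
    using insert.prems by auto
  have s: "finsum R f A \<in> carrier R" "finsum R g A \<in> carrier R"
    using c by auto
  have "(f a \<oplus> finsum R f A) \<ominus> (g a \<oplus> finsum R g A)
      = (f a \<ominus> g a) \<oplus> (finsum R f A \<ominus> finsum R g A)"
    using c(1,2) s by (simp add: a_minus_def minus_add a_ac)
  moreover have "\<dots> \<in> I"
    using insert additive_subgroup.a_closed[OF additive_subgroup_axioms] by simp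
  ultimately show ?case
    using insert.hyps c by simp
qed

text \<open>
  Modulo \<open>I\<close> the \<open>e i\<close> act as Kronecker deltas at \<open>j\<close>, so the combination collapses to its
  \<open>j\<close>-th term. This evaluates Chinese remainder combinations at one of the moduli.
\<close>
lemma (in ideal) finsum_select_cong_mod:
  assumes "finite A" and "j \<in> A"
    and e: "e \<in> A \<rightarrow> carrier R" and x: "x \<in> A \<rightarrow> carrier R"
    and one: "e j \<ominus> \<one> \<in> I" and other: "\<And>i. i \<in> A \<Longrightarrow> i \<noteq> j \<Longrightarrow> e i \<in> I"
  shows "(\<Oplus>i \<in> A. e i \<otimes> x i) \<ominus> x j \<in> I"
proof -
  have "e i \<otimes> x i \<ominus> (if j = i then x i else \<zero>) \<in> I" if "i \<in> A" for i
  proof (cases "j = i")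
    case True
    have "e i \<otimes> x i \<ominus> x i = (e i \<ominus> \<one>) \<otimes> x i"
      using that e x by (simp add: Pi_def a_minus_def l_distr l_minus)
    then show ?thesis
      using True one that x I_r_closed by (auto simp: Pi_def)
  next
    case False
    then show ?thesis
      using that x other[of i] I_r_closed[of "e i" "x i"] by (auto simp: Pi_def a_minus_def)
  qed
  then have "(\<Oplus>i \<in> A. e i \<otimes> x i) \<ominus> (\<Oplus>i \<in> A. if j = i then x i else \<zero>) \<in> I"
    using assms by (intro finsum_cong_mod) (auto simp: Pi_def)
  also have "(\<Oplus>i \<in> A. if j = i then x i else \<zero>) = x j"
    using assms add.finprod_singleton[of j A x] by simp
  finally show ?thesis .
qed

text \<open>
  The residue ring is a field; in ideal terms, \<open>aR + I\<close> properly contains \<open>I\<close> and hence contains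
  \<open>\<one>\<close>.
\<close>
lemma (in maximalideal) ex_inverse_mod:
  assumes "cring R" and a: "a \<in> carrier R" "a \<notin> I"
  shows "\<exists>b \<in> carrier R. a \<otimes> b \<ominus> \<one> \<in> I"
proof -
  interpret cring R by fact
  have id: "ideal (PIdl a <+> I) R"
    using a by (intro add_ideals cgenideal_ideal is_ideal)
  have mem: "x \<oplus> i \<in> PIdl a <+> I" if "x \<in> PIdl a" "i \<in> I" for x i
    using that unfolding set_add_def' by blast
  have sub: "I \<subseteq> PIdl a <+> I"
  proof
    fix i assume i: "i \<in> I"
    have "\<zero> \<in> PIdl a" unfolding cgenideal_def using a(1) l_null[of a] zero_closed by (metis (mono_tags, lifting) mem_Collect_eq)
    from mem[OF this i] i show "i \<in> PIdl a <+> I" by (simp add: a_Hcarr)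
  qed
  have "a \<in> PIdl a <+> I"
    using mem[OF cgenideal_self[OF a(1)], of \<zero>] a by simp
  with a(2) have "PIdl a <+> I = carrier R"
    using I_maximal[OF id sub] ideal.Icarr[OF id] by blast
  then have "\<one> \<in> PIdl a <+> I" by simp
  then obtain x i where xi: "x \<in> carrier R" "i \<in> I" "\<one> = x \<otimes> a \<oplus> i"
    unfolding set_add_def' cgenideal_def by blast
  have ic: "i \<in> carrier R" using xi a_Hcarr by simp
  have "a \<otimes> x \<ominus> \<one> = \<ominus> i"
    unfolding xi(3) using xi(1) a ic by algebra
  then have "a \<otimes> x \<ominus> \<one> \<in> I"
    using xi(2) additive_subgroup.a_inv_closed[OF additive_subgroup_axioms, of i] by simp
  then show ?thesis using xi(1) by blast
qed

text \<open>
  One half of the Chinese remainder theorem, with the witness kept inside the subring \<open>K\<close>: a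
  product of elements \<open>b\<^sub>j \<in> K \<inter> M j\<close>, each congruent to \<open>\<one>\<close> modulo \<open>N\<close>, is still congruent to
  \<open>\<one>\<close> and lies in every \<open>M j\<close>.
\<close>
lemma (in cring) ex_indicator_mod_ideals:
  assumes K: "subring K R" and "finite J"
    and "ideal N R" and "\<And>j. j \<in> J \<Longrightarrow> ideal (M j) R"
    and "\<And>j. j \<in> J \<Longrightarrow> \<exists>b \<in> K \<inter> M j. b \<ominus> \<one> \<in> N"
  shows "\<exists>e \<in> K. (\<forall>j \<in> J. e \<in> M j) \<and> e \<ominus> \<one> \<in> N"
  using \<open>finite J\<close> assms(4,5)
proof (induction J)
  case empty
  interpret N: ideal N R by fact
  show ?case
    using subringE(3)[OF K] by (intro bexI[of _ "\<one>"]) (simp_all add: r_neg a_minus_def)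
next
  case (insert j J)
  interpret N: ideal N R by fact
  interpret Mj: ideal "M j" R using insert.prems by simp
  obtain e where e: "e \<in> K" "\<forall>i \<in> J. e \<in> M i" "e \<ominus> \<one> \<in> N"
    using insert.IH insert.prems by auto
  obtain b where b: "b \<in> K" "b \<in> M j" "b \<ominus> \<one> \<in> N"
    using insert.prems(2)[of j] by auto
  have c: "e \<in> carrier R" "b \<in> carrier R"
    using e b subringE(1)[OF K] by auto
  have "b \<otimes> e \<ominus> \<one> = (b \<ominus> \<one>) \<otimes> e \<oplus> (e \<ominus> \<one>)"
    using c by algebra
  then have "b \<otimes> e \<ominus> \<one> \<in> N"
    using e b c by (simp add: N.I_r_closed)
  moreover have "b \<otimes> e \<in> M i" if "i \<in> insert j J" for i
    using that e b c ideal.I_l_closed[OF insert.prems(1)[OF that]] Mj.I_r_closed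
    by auto
  ultimately show ?case
    using subringE(6)[OF K b(1) e(1)] by blast
qed

section \<open>Formal power series over a carrier set\<close>

lemma power_series_ring_simps [simp]:
  "carrier (power_series_ring A) = UNIV \<rightarrow> carrier A"
  "(f \<otimes>\<^bsub>power_series_ring A\<^esub> g) n = (\<Oplus>\<^bsub>A\<^esub>i \<in> {..n}. f i \<otimes>\<^bsub>A\<^esub> g (n - i))"
  "\<one>\<^bsub>power_series_ring A\<^esub> = (\<lambda>n. if n = 0 then \<one>\<^bsub>A\<^esub> else \<zero>\<^bsub>A\<^esub>)"
  "\<zero>\<^bsub>power_series_ring A\<^esub> = (\<lambda>n. \<zero>\<^bsub>A\<^esub>)"
  "f \<oplus>\<^bsub>power_series_ring A\<^esub> g = (\<lambda>n. f n \<oplus>\<^bsub>A\<^esub> g n)"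
  by (simp_all add: power_series_ring_def)

lemma (in cring) power_series_mult_comm:
  assumes "f \<in> UNIV \<rightarrow> carrier R" and "g \<in> UNIV \<rightarrow> carrier R"
  shows "f \<otimes>\<^bsub>power_series_ring R\<^esub> g = g \<otimes>\<^bsub>power_series_ring R\<^esub> f"
proof
  fix n :: nat
  have inj: "inj_on (\<lambda>i. n - i) {..n}"
    by (auto simp: inj_on_def)
  have img: "(\<lambda>i. n - i) ` {..n} = {..n}"
    by (auto simp: image_iff) (metis atMost_iff diff_diff_cancel diff_le_self)
  have "(\<Oplus>i \<in> {..n}. f i \<otimes> g (n - i)) = (\<Oplus>i \<in> (\<lambda>i. n - i) ` {..n}. f i \<otimes> g (n - i))"
    by (simp add: img)
  also have "\<dots> = (\<Oplus>i \<in> {..n}. f (n - i) \<otimes> g (n - (n - i)))"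
    using assms inj by (intro finsum_reindex) (auto simp: Pi_def)
  also have "\<dots> = (\<Oplus>i \<in> {..n}. g i \<otimes> f (n - i))"
    using assms by (intro finsum_cong') (auto simp: Pi_def m_comm)
  finally show "(f \<otimes>\<^bsub>power_series_ring R\<^esub> g) n = (g \<otimes>\<^bsub>power_series_ring R\<^esub> f) n"
    by simp
qed

lemma (in cring) power_series_mult_add_right:
  assumes "f \<in> UNIV \<rightarrow> carrier R" "g \<in> UNIV \<rightarrow> carrier R" "h \<in> UNIV \<rightarrow> carrier R"
  shows "(f \<otimes>\<^bsub>power_series_ring R\<^esub> (\<lambda>n. g n \<oplus> h n)) n
    = (f \<otimes>\<^bsub>power_series_ring R\<^esub> g) n \<oplus> (f \<otimes>\<^bsub>power_series_ring R\<^esub> h) n"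
proof -
  have "(\<Oplus>i \<in> {..n}. f i \<otimes> (g (n - i) \<oplus> h (n - i)))
      = (\<Oplus>i \<in> {..n}. f i \<otimes> g (n - i) \<oplus> f i \<otimes> h (n - i))"
    using assms by (intro finsum_cong') (auto simp: Pi_def r_distr)
  also have "\<dots> = (\<Oplus>i \<in> {..n}. f i \<otimes> g (n - i)) \<oplus> (\<Oplus>i \<in> {..n}. f i \<otimes> h (n - i))"
    using assms by (intro finsum_addf) (auto simp: Pi_def)
  finally show ?thesis by simp
qed

lemma (in cring) power_series_mult_smult_right:
  assumes "f \<in> UNIV \<rightarrow> carrier R" "g \<in> UNIV \<rightarrow> carrier R" "c \<in> carrier R"
  shows "(f \<otimes>\<^bsub>power_series_ring R\<^esub> (\<lambda>n. c \<otimes> g n)) n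
    = c \<otimes> (f \<otimes>\<^bsub>power_series_ring R\<^esub> g) n"
proof -
  have "(\<Oplus>i \<in> {..n}. f i \<otimes> (c \<otimes> g (n - i))) = (\<Oplus>i \<in> {..n}. c \<otimes> (f i \<otimes> g (n - i)))"
    using assms by (intro finsum_cong') (auto simp: Pi_def m_lcomm)
  also have "\<dots> = c \<otimes> (\<Oplus>i \<in> {..n}. f i \<otimes> g (n - i))"
    using assms by (intro finsum_rdistr[symmetric]) (auto simp: Pi_def)
  finally show ?thesis by simp
qed

lemma (in cring) power_series_mult_const_right:
  assumes "f \<in> UNIV \<rightarrow> carrier R" "c \<in> carrier R"
  shows "(f \<otimes>\<^bsub>power_series_ring R\<^esub> (\<lambda>n. if n = 0 then c else \<zero>)) n = f n \<otimes> c"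
proof -
  have "(\<Oplus>i \<in> {..n}. f i \<otimes> (if n - i = 0 then c else \<zero>))
      = (\<Oplus>i \<in> {..n}. if n = i then f i \<otimes> c else \<zero>)"
    using assms by (intro finsum_cong') (auto simp: Pi_def)
  also have "\<dots> = f n \<otimes> c"
    using assms add.finprod_singleton[of n "{..n}" "\<lambda>i. f i \<otimes> c"] by (auto simp: Pi_def)
  finally show ?thesis by simp
qed

lemma (in cring) power_series_mult_lincomb_right:
  assumes "finite A" and f: "f \<in> UNIV \<rightarrow> carrier R"
    and "e \<in> A \<rightarrow> carrier R" and "\<And>i. i \<in> A \<Longrightarrow> h i \<in> UNIV \<rightarrow> carrier R"
  shows "(f \<otimes>\<^bsub>power_series_ring R\<^esub> (\<lambda>n. \<Oplus>i \<in> A. e i \<otimes> h i n)) n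
    = (\<Oplus>i \<in> A. e i \<otimes> (f \<otimes>\<^bsub>power_series_ring R\<^esub> h i) n)"
  using assms(1,3,4)
proof (induction A)
  case empty
  show ?case
    using power_series_mult_const_right[OF f, of \<zero>] f
    by (simp add: Pi_def del: power_series_ring_simps(2))
next
  case (insert a A)
  have c: "e a \<in> carrier R" "h a \<in> UNIV \<rightarrow> carrier R" "\<And>n. h a n \<in> carrier R"
    using insert.prems by auto
  have cA: "(\<lambda>i. e i \<otimes> h i n) \<in> A \<rightarrow> carrier R" for n
    using insert.prems by (auto simp: Pi_def)
  have mc: "(f \<otimes>\<^bsub>power_series_ring R\<^esub> h i) n \<in> carrier R" if "i \<in> insert a A" for i
    using f insert.prems(2)[OF that] by (auto simp: Pi_def)
  have mcA: "(\<lambda>i. e i \<otimes> (f \<otimes>\<^bsub>power_series_ring R\<^esub> h i) n) \<in> A \<rightarrow> carrier R"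
    using mc insert.prems(1) by (auto simp del: power_series_ring_simps(2))
  have "(f \<otimes>\<^bsub>power_series_ring R\<^esub> (\<lambda>n. \<Oplus>i \<in> insert a A. e i \<otimes> h i n)) n
      = (f \<otimes>\<^bsub>power_series_ring R\<^esub> (\<lambda>n. e a \<otimes> h a n \<oplus> (\<Oplus>i \<in> A. e i \<otimes> h i n))) n"
    using insert.hyps c cA by (simp del: power_series_ring_simps(2))
  also have "\<dots> = (f \<otimes>\<^bsub>power_series_ring R\<^esub> (\<lambda>n. e a \<otimes> h a n)) n
      \<oplus> (f \<otimes>\<^bsub>power_series_ring R\<^esub> (\<lambda>n. \<Oplus>i \<in> A. e i \<otimes> h i n)) n"
    using f c cA by (intro power_series_mult_add_right) auto
  also have "\<dots> = (\<Oplus>i \<in> insert a A. e i \<otimes> (f \<otimes>\<^bsub>power_series_ring R\<^esub> h i) n)"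
    using insert c f mc mcA
    by (simp add: power_series_mult_smult_right del: power_series_ring_simps(2))
  finally show ?case .
qed

lemma (in cring) subring_power_series:
  assumes K: "subring K R"
  shows "subring (UNIV \<rightarrow> K) (power_series_ring R)"
proof -
  note KE = subringE[OF K]
  interpret P: abelian_group "power_series_ring R"
  proof (rule abelian_groupI)
    fix f assume "f \<in> carrier (power_series_ring R)"
    then show "\<exists>g \<in> carrier (power_series_ring R). g \<oplus>\<^bsub>power_series_ring R\<^esub> f = \<zero>\<^bsub>power_series_ring R\<^esub>"
      by (intro bexI[of _ "\<lambda>n. \<ominus> f n"]) (auto simp: Pi_def l_neg)
  qed (auto simp: Pi_def a_ac)
  have KE1: "x \<in> K \<Longrightarrow> x \<in> carrier R" for x using KE(1) by blast
  have neg: "\<ominus>\<^bsub>power_series_ring R\<^esub> f = (\<lambda>n. \<ominus> f n)" if "f \<in> UNIV \<rightarrow> K" for f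
    using that KE1 by (intro P.minus_equality) (auto simp: Pi_def l_neg)
  have "subgroup (UNIV \<rightarrow> K) (add_monoid (power_series_ring R))"
  proof (rule subgroup.intro)
    fix f :: "nat \<Rightarrow> 'a" assume f: "f \<in> UNIV \<rightarrow> K"
    show "inv\<^bsub>add_monoid (power_series_ring R)\<^esub> f \<in> UNIV \<rightarrow> K"
      using neg[OF f] f KE(5) by (auto simp: a_inv_def Pi_def)
  qed (use KE KE1 in \<open>auto simp: Pi_def\<close>)
  moreover have "submonoid (UNIV \<rightarrow> K) (power_series_ring R)"
  proof (rule submonoid.intro)
    fix f g :: "nat \<Rightarrow> 'a" assume fg: "f \<in> UNIV \<rightarrow> K" "g \<in> UNIV \<rightarrow> K"
    have "(f \<otimes>\<^bsub>power_series_ring R\<^esub> g) n \<in> K" for n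
      unfolding power_series_ring_simps
      using fg KE by (intro finsum_mem_of_add_closed) (auto simp: Pi_def)
    then show "f \<otimes>\<^bsub>power_series_ring R\<^esub> g \<in> UNIV \<rightarrow> K" by blast
  qed (use KE KE1 in \<open>auto simp: Pi_def\<close>)
  ultimately show ?thesis by (rule subring.intro)
qed

text \<open>
  The equation \<open>f g = 1\<close> determines the coefficients of \<open>g\<close> one after the other: the coefficient
  of index \<open>Suc m\<close> reads \<open>(\<Sum>i\<le>m. f (Suc i) g (m - i)) + f 0 g (Suc m) = 0\<close>, and \<open>f 0\<close> can be
  divided out.
\<close>
lemma (in cring) ex_power_series_inverse:
  assumes f: "f \<in> UNIV \<rightarrow> carrier R" and u: "f 0 \<in> Units R"
  shows "\<exists>g \<in> UNIV \<rightarrow> carrier R. f \<otimes>\<^bsub>power_series_ring R\<^esub> g = \<one>\<^bsub>power_series_ring R\<^esub>"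
proof -
  have fc: "f i \<in> carrier R" for i using f by auto
  \<comment> \<open>\<open>P g n r\<close> says that \<open>r\<close> may be taken as the coefficient of index \<open>n\<close>, given the values of
    \<open>g\<close> below \<open>n\<close>; only these are read, as well-founded choice requires.\<close>
  define P where "P = (\<lambda>g n r. r \<in> carrier R \<and>
    (case n of 0 \<Rightarrow> f 0 \<otimes> r = \<one>
     | Suc m \<Rightarrow> (\<Oplus>i \<in> {..m}. f (Suc i) \<otimes> g (m - i)) \<oplus> f 0 \<otimes> r = \<zero>))"
  have "\<exists>g. \<forall>n. P g n (g n)"
  proof (rule dependent_wf_choice[OF wf_less_than])
    fix g g' :: "nat \<Rightarrow> 'a" and n :: nat and r
    assume eq: "\<And>k. (k, n) \<in> less_than \<Longrightarrow> g k = g' k"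
    show "P g n r = P g' n r"
    proof (cases n)
      case (Suc m)
      then have "(\<lambda>i. f (Suc i) \<otimes> g (m - i)) = (\<lambda>i. f (Suc i) \<otimes> g' (m - i))"
        using eq by auto
      then show ?thesis unfolding P_def Suc by simp
    qed (simp add: P_def)
  next
    fix n :: nat and g :: "nat \<Rightarrow> 'a"
    assume IH: "\<And>k. (k, n) \<in> less_than \<Longrightarrow> P g k (g k)"
    show "\<exists>r. P g n r"
    proof (cases n)
      case 0
      then show ?thesis
        using u by (intro exI[of _ "inv (f 0)"]) (simp add: P_def)
    next
      case (Suc m)
      have "g (m - i) \<in> carrier R" for i
        using IH[of "m - i"] Suc by (simp add: P_def)
      then have s: "(\<Oplus>i \<in> {..m}. f (Suc i) \<otimes> g (m - i)) \<in> carrier R" (is "?s \<in> _")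
        using fc by (intro finsum_closed) auto
      have "?s \<oplus> f 0 \<otimes> (inv (f 0) \<otimes> (\<ominus> ?s)) = \<zero>"
        using s u fc by (simp add: m_assoc[symmetric] r_neg)
      then show ?thesis
        using Suc s u by (intro exI[of _ "inv (f 0) \<otimes> (\<ominus> ?s)"]) (simp add: P_def)
    qed
  qed
  then obtain g where g: "\<And>n. P g n (g n)" by blast
  have gc: "g n \<in> carrier R" for n using g[of n] by (simp add: P_def)
  have "(f \<otimes>\<^bsub>power_series_ring R\<^esub> g) n = (if n = 0 then \<one> else \<zero>)" for n
  proof (cases n)
    case 0
    then show ?thesis using g[of 0] fc gc by (simp add: P_def)
  next
    case (Suc m)
    have "(\<Oplus>i \<in> {..Suc m}. f i \<otimes> g (Suc m - i))
        = (\<Oplus>i \<in> {..m}. f (Suc i) \<otimes> g (m - i)) \<oplus> f 0 \<otimes> g (Suc m)"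
      using fc gc by (subst finsum_Suc2) auto
    also have "\<dots> = \<zero>" using g[of "Suc m"] by (simp add: P_def)
    finally show ?thesis using Suc by simp
  qed
  then show ?thesis using gc by (intro bexI[of _ g]) auto
qed

lemma (in cring) power_series_Units:
  assumes "f \<in> UNIV \<rightarrow> carrier R" and "f 0 \<in> Units R"
  shows "f \<in> Units (power_series_ring R)"
  using ex_power_series_inverse[OF assms] assms(1) power_series_mult_comm
  unfolding Units_def by (auto simp del: power_series_ring_simps(2,3))

lemma (in abelian_monoid) finsum_atMost_drop_zeros:
  assumes "f \<in> UNIV \<rightarrow> carrier G" and "\<And>i. i < k \<Longrightarrow> f i = \<zero>"
  shows "(\<Oplus>i \<in> {..k + m :: nat}. f i) = (\<Oplus>i \<in> {..m}. f (k + i))"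
  using assms
proof (induction k arbitrary: f)
  case (Suc k)
  have "(\<Oplus>i \<in> {..Suc (k + m)}. f i) = (\<Oplus>i \<in> {..k + m}. f (Suc i)) \<oplus> f 0"
    using Suc.prems by (intro finsum_Suc2) auto
  also have "\<dots> = (\<Oplus>i \<in> {..k + m}. f (Suc i))"
    using Suc.prems by (simp add: Pi_def)
  also have "\<dots> = (\<Oplus>i \<in> {..m}. f (Suc (k + i)))"
    using Suc.prems by (intro Suc.IH) auto
  finally show ?case by simp
qed simp

text \<open>
  Over the residue field a nonzero series is \<open>x ^ k\<close> times a unit, and \<open>h\<close> lifts the inverse of
  that unit; for a series that vanishes modulo \<open>I\<close>, the constant \<open>1\<close> will do. In both cases \<open>f h\<close>
  reduces to a series with coefficients \<open>0\<close> and \<open>1\<close>. Only this, and not the exponent \<open>k\<close>, is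
  recorded: it is what makes the product land in any given subring up to \<open>I\<close>.
\<close>
lemma (in maximalideal) power_series_monomial_mod:
  assumes "cring R" and f: "f \<in> UNIV \<rightarrow> carrier R"
  shows "\<exists>h \<in> UNIV \<rightarrow> carrier R. (\<exists>b \<in> carrier R. h 0 \<otimes> b \<ominus> \<one> \<in> I) \<and>
    (\<forall>n. \<exists>c \<in> {\<zero>, \<one>}. (f \<otimes>\<^bsub>power_series_ring R\<^esub> h) n \<ominus> c \<in> I)"
proof -
  interpret cring R by fact
  have fc: "f i \<in> carrier R" for i using f by auto
  show ?thesis
  proof (cases "\<forall>n. f n \<in> I")
    case True
    have "(f \<otimes>\<^bsub>power_series_ring R\<^esub> (\<lambda>n. if n = 0 then \<one> else \<zero>)) n \<ominus> \<zero> \<in> I" for n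
      using True fc power_series_mult_const_right[OF f one_closed, of n]
      by (simp add: a_minus_def del: power_series_ring_simps(2))
    then show ?thesis
      by (intro bexI[of _ "\<lambda>n. if n = 0 then \<one> else \<zero>"])
        (auto simp: a_minus_def r_neg simp del: power_series_ring_simps(2) intro!: bexI[of _ \<one>])
  next
    case False
    define k where "k = (LEAST n. f n \<notin> I)"
    have k: "f k \<notin> I" and less: "\<And>i. i < k \<Longrightarrow> f i \<in> I"
      using False LeastI_ex[of "\<lambda>n. f n \<notin> I"] not_less_Least[of _ "\<lambda>n. f n \<notin> I"]
      unfolding k_def by blast+
    obtain a where a: "a \<in> carrier R" "f k \<otimes> a \<ominus> \<one> \<in> I"
      using ex_inverse_mod[OF \<open>cring R\<close> fc k] by blast
    \<comment> \<open>A series congruent to \<open>f a\<close> modulo \<open>I\<close>, whose first \<open>k\<close> coefficients vanish and whose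
      next one is exactly \<open>1\<close>; dividing by \<open>x ^ k\<close> makes it invertible already over \<open>R\<close>, so that
      no power series over the quotient have to be lifted.\<close>
    define F where "F = (\<lambda>i. if i < k then \<zero> else if i = k then \<one> else f i \<otimes> a)"
    have Fc: "F i \<in> carrier R" for i using fc a by (simp add: F_def)
    have F: "f i \<otimes> a \<ominus> F i \<in> I" for i
      using fc a less[of i] by (auto simp: F_def a_minus_def r_neg I_r_closed)
    obtain g where g: "g \<in> UNIV \<rightarrow> carrier R"
      "(\<lambda>i. F (k + i)) \<otimes>\<^bsub>power_series_ring R\<^esub> g = \<one>\<^bsub>power_series_ring R\<^esub>"
    proof -
      have "(\<lambda>i. F (k + i)) \<in> UNIV \<rightarrow> carrier R" "F (k + 0) \<in> Units R"
        using Fc by simp_all (simp add: F_def)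
      from ex_power_series_inverse[OF this] show ?thesis using that by blast
    qed
    have gc: "g i \<in> carrier R" for i using g(1) by auto
    have g_inv: "(\<Oplus>i \<in> {..m}. F (k + i) \<otimes> g (m - i)) = (if m = 0 then \<one> else \<zero>)" for m
      using fun_cong[OF g(2), of m] by simp
    have g0: "g 0 = \<one>" using g_inv[of 0] gc by (simp add: F_def)
    define h where "h = (\<lambda>n. a \<otimes> g n)"
    have h: "h \<in> UNIV \<rightarrow> carrier R" using a gc by (simp add: h_def)
    have Fg: "(\<Oplus>i \<in> {..n}. F i \<otimes> g (n - i)) \<in> {\<zero>, \<one>}" for n
    proof (cases "n < k")
      case True
      then have "(\<Oplus>i \<in> {..n}. F i \<otimes> g (n - i)) = (\<Oplus>i \<in> {..n}. \<zero>)"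
        using gc by (intro finsum_cong') (auto simp: F_def)
      then show ?thesis by simp
    next
      case False
      then obtain m where n: "n = k + m" using le_Suc_ex[of k n] by auto
      have "(\<Oplus>i \<in> {..k + m}. F i \<otimes> g (k + m - i)) = (\<Oplus>i \<in> {..m}. F (k + i) \<otimes> g (k + m - (k + i)))"
        using Fc gc by (intro finsum_atMost_drop_zeros) (auto simp: F_def)
      then show ?thesis using g_inv[of m] n by simp
    qed
    have "(f \<otimes>\<^bsub>power_series_ring R\<^esub> h) n \<ominus> (\<Oplus>i \<in> {..n}. F i \<otimes> g (n - i)) \<in> I" for n
      unfolding power_series_ring_simps h_def
    proof (rule finsum_cong_mod)
      fix i
      have "f i \<otimes> (a \<otimes> g (n - i)) \<ominus> F i \<otimes> g (n - i) = (f i \<otimes> a \<ominus> F i) \<otimes> g (n - i)"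
        using fc[of i] Fc[of i] gc[of "n - i"] a(1) by algebra
      then show "f i \<otimes> (a \<otimes> g (n - i)) \<ominus> F i \<otimes> g (n - i) \<in> I"
        using F gc I_r_closed by simp
    qed (use fc Fc gc a in auto)
    then have "\<exists>c \<in> {\<zero>, \<one>}. (f \<otimes>\<^bsub>power_series_ring R\<^esub> h) n \<ominus> c \<in> I" for n
      using Fg by blast
    moreover have "h 0 \<otimes> f k \<ominus> \<one> \<in> I"
      using a fc g0 by (simp add: h_def m_comm)
    ultimately show ?thesis using h fc by blast
  qed
qed

section \<open>Gluing along the maximal ideals\<close>

text \<open>
  The local multipliers \<open>h i\<close> are combined by elements \<open>e i\<close> of \<open>K\<close> that are orthogonal
  idempotents modulo \<open>\<Inter>i. M i\<close>. Writing \<open>f (h i) = c + p\<close> with \<open>c \<in> {0, 1}\<close> and \<open>p \<in> M i\<close>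
  coefficientwise, both \<open>e i c\<close> and \<open>e i p\<close> lie in \<open>K\<close>, the latter because \<open>e i\<close> lies in all
  the other maximal ideals. The same \<open>e i\<close> glue the local inverses of the constant terms.
\<close>
lemma (in cring) ex_power_series_multiplier:
  assumes K: "subring K R" and "finite A"
    and M: "\<And>i. i \<in> A \<Longrightarrow> maximalideal (M i) R"
    and IK: "carrier R \<inter> (\<Inter>i \<in> A. M i) \<subseteq> K"
    and com: "\<And>i j. i \<in> A \<Longrightarrow> j \<in> A \<Longrightarrow> i \<noteq> j \<Longrightarrow>
      comaximal (R\<lparr>carrier := K\<rparr>) (K \<inter> M i) (K \<inter> M j)"
    and f: "f \<in> UNIV \<rightarrow> carrier R"
  shows "\<exists>h \<in> UNIV \<rightarrow> carrier R. f \<otimes>\<^bsub>power_series_ring R\<^esub> h \<in> UNIV \<rightarrow> K \<and>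
    (\<exists>b \<in> carrier R. \<forall>i \<in> A. h 0 \<otimes> b \<ominus> \<one> \<in> M i)"
proof -
  note KE = subringE[OF K]
  have id: "ideal (M i) R" if "i \<in> A" for i
    using M[OF that] by (rule maximalideal.axioms)
  have "\<exists>e \<in> K. (\<forall>j \<in> A - {i}. e \<in> M j) \<and> e \<ominus> \<one> \<in> M i" if i: "i \<in> A" for i
  proof (rule ex_indicator_mod_ideals[OF K])
    fix j assume j: "j \<in> A - {i}"
    interpret Mi: ideal "M i" R by (rule id[OF i])
    have "\<one> \<in> K" by (rule KE)
    then have "\<one> \<in> (K \<inter> M i) <+>\<^bsub>R\<lparr>carrier := K\<rparr>\<^esub> (K \<inter> M j)"
      using com[of i j] i j unfolding comaximal_def by auto
    then obtain a b where ab: "a \<in> K" "a \<in> M i" "b \<in> K" "b \<in> M j" "\<one> = a \<oplus> b"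
      unfolding set_add_def' by auto
    have c: "a \<in> carrier R" "b \<in> carrier R" using ab KE(1) by auto
    have "b \<ominus> \<one> = \<ominus> a" unfolding ab(5) using c by algebra
    then have "b \<ominus> \<one> \<in> M i" using ab(2) by simp
    then show "\<exists>b \<in> K \<inter> M j. b \<ominus> \<one> \<in> M i"
      using ab(3,4) by blast
  qed (use id i \<open>finite A\<close> in auto)
  then obtain e where e: "\<And>i. i \<in> A \<Longrightarrow> e i \<in> K" "\<And>i. i \<in> A \<Longrightarrow> e i \<ominus> \<one> \<in> M i"
    "\<And>i j. i \<in> A \<Longrightarrow> j \<in> A \<Longrightarrow> i \<noteq> j \<Longrightarrow> e i \<in> M j"
    by (metis Diff_iff singletonD)
  have ec: "e \<in> A \<rightarrow> carrier R" using e(1) KE(1) by auto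
  have "\<forall>i \<in> A. \<exists>h b. h \<in> UNIV \<rightarrow> carrier R \<and> b \<in> carrier R \<and> h 0 \<otimes> b \<ominus> \<one> \<in> M i \<and>
      (\<forall>n. \<exists>c \<in> {\<zero>, \<one>}. (f \<otimes>\<^bsub>power_series_ring R\<^esub> h) n \<ominus> c \<in> M i)"
    using maximalideal.power_series_monomial_mod[OF M is_cring f] by blast
  then obtain h b where hb: "\<forall>i \<in> A. h i \<in> UNIV \<rightarrow> carrier R \<and> b i \<in> carrier R \<and>
      h i 0 \<otimes> b i \<ominus> \<one> \<in> M i \<and>
      (\<forall>n. \<exists>c \<in> {\<zero>, \<one>}. (f \<otimes>\<^bsub>power_series_ring R\<^esub> h i) n \<ominus> c \<in> M i)"
    by metis
  have hc: "h i n \<in> carrier R" if "i \<in> A" for i n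
    using hb that by (auto simp: Pi_def)
  define H where "H = (\<lambda>n. \<Oplus>i \<in> A. e i \<otimes> h i n)"
  define B where "B = (\<Oplus>i \<in> A. e i \<otimes> b i)"
  have Hc: "H n \<in> carrier R" for n
    unfolding H_def using ec hb by (intro finsum_closed) (auto simp: Pi_def)
  have Bc: "B \<in> carrier R"
    unfolding B_def using ec hb by (intro finsum_closed) (auto simp: Pi_def)
  have "(f \<otimes>\<^bsub>power_series_ring R\<^esub> H) n \<in> K" for n
  proof -
    have "e i \<otimes> (f \<otimes>\<^bsub>power_series_ring R\<^esub> h i) n \<in> K" if i: "i \<in> A" for i
    proof -
      obtain c where c: "c \<in> {\<zero>, \<one>}" "(f \<otimes>\<^bsub>power_series_ring R\<^esub> h i) n \<ominus> c \<in> M i"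
        using hb i by blast
      define p where "p = (f \<otimes>\<^bsub>power_series_ring R\<^esub> h i) n"
      have pc: "p \<in> carrier R"
        using f hb i unfolding p_def power_series_ring_simps
        by (intro finsum_closed) (auto simp: Pi_def)
      have cc: "c \<in> carrier R" "c \<in> K" using c(1) KE by auto
      have eic: "e i \<in> carrier R" using ec i by auto
      have "e i \<otimes> (p \<ominus> c) \<in> M j" if "j \<in> A" for j
        using ideal.I_l_closed[OF id[OF i]] ideal.I_r_closed[OF id[OF that]]
          e(3)[OF i that] c(2)[folded p_def] eic pc cc(1) by (cases "i = j") auto
      then have "e i \<otimes> (p \<ominus> c) \<in> K"
        using IK eic pc cc by auto
      moreover have "e i \<otimes> p = e i \<otimes> (p \<ominus> c) \<oplus> e i \<otimes> c"
        using eic pc cc(1) by algebra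
      ultimately show ?thesis
        using KE(6,7) e(1)[OF i] cc unfolding p_def[symmetric] by simp
    qed
    then have "(\<Oplus>i \<in> A. e i \<otimes> (f \<otimes>\<^bsub>power_series_ring R\<^esub> h i) n) \<in> K"
      using KE by (intro finsum_mem_of_add_closed) (auto simp: Pi_def)
    then show ?thesis
      unfolding H_def
      using power_series_mult_lincomb_right[OF \<open>finite A\<close> f ec, of h n] hb
      by (simp del: power_series_ring_simps(2))
  qed
  moreover have "H 0 \<otimes> B \<ominus> \<one> \<in> M j" if j: "j \<in> A" for j
  proof -
    interpret Mj: ideal "M j" R by (rule id[OF j])
    have 1: "H 0 \<ominus> h j 0 \<in> M j"
      unfolding H_def using \<open>finite A\<close> j ec e hc
      by (intro Mj.finsum_select_cong_mod) auto
    have 2: "B \<ominus> b j \<in> M j"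
      unfolding B_def using \<open>finite A\<close> j ec e hb
      by (intro Mj.finsum_select_cong_mod) auto
    have 3: "h j 0 \<otimes> b j \<ominus> \<one> \<in> M j" using hb j by blast
    have c: "h j 0 \<in> carrier R" "b j \<in> carrier R" using hb j by auto
    have "H 0 \<otimes> B \<ominus> \<one> = (H 0 \<ominus> h j 0) \<otimes> B \<oplus> h j 0 \<otimes> (B \<ominus> b j) \<oplus> (h j 0 \<otimes> b j \<ominus> \<one>)"
      using Hc[of 0] Bc c by algebra
    then show ?thesis
      using 1 2 3 Bc c by (simp add: Mj.I_l_closed Mj.I_r_closed)
  qed
  ultimately show ?thesis
    using Hc Bc by (intro bexI[of _ H]) auto
qed

section \<open>Associatedness of the power series rings\<close>

theorem theorem5p4:
  fixes T :: "('a, 'm) ring_scheme" and R :: "'a set"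
    and n :: nat and M :: "nat \<Rightarrow> 'a set"
  assumes "cring T"
    and "subring R T"
    and "associated_subring R T"
    and "locally_associated_subring R T"
    and "\<And>i. i \<in> {1..n} \<Longrightarrow> maximalideal (M i) T"
    and "conductor R T = carrier T \<inter> (\<Inter>i \<in> {1..n}. M i)"
    and "\<And>i j. i \<in> {1..n} \<Longrightarrow> j \<in> {1..n} \<Longrightarrow> i \<noteq> j \<Longrightarrow>
           comaximal (T\<lparr>carrier := R\<rparr>) (R \<inter> M i) (R \<inter> M j)"
  shows "associated_subring (carrier (power_series_ring (T\<lparr>carrier := R\<rparr>))) (power_series_ring T)"
proof -
  interpret T: cring T by fact
  note RE = subringE[OF \<open>subring R T\<close>]
  let ?P = "power_series_ring T" and ?I = "conductor R T"
  have IR: "?I \<subseteq> R" by (auto simp: conductor_def)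
  have I_mult: "x \<otimes>\<^bsub>T\<^esub> t \<in> R" if "x \<in> ?I" "t \<in> carrier T" for x t
    using that by (simp add: conductor_def)
  have "\<exists>v \<in> Units ?P. f \<otimes>\<^bsub>?P\<^esub> v \<in> UNIV \<rightarrow> R" if "f \<in> carrier ?P" for f
  proof -
    have f: "f \<in> UNIV \<rightarrow> carrier T" using that by simp
    obtain h b where h: "h \<in> UNIV \<rightarrow> carrier T" "f \<otimes>\<^bsub>?P\<^esub> h \<in> UNIV \<rightarrow> R"
      and b: "b \<in> carrier T" "\<And>i. i \<in> {1..n} \<Longrightarrow> h 0 \<otimes>\<^bsub>T\<^esub> b \<ominus>\<^bsub>T\<^esub> \<one>\<^bsub>T\<^esub> \<in> M i"
    proof -
      have "carrier T \<inter> (\<Inter>i \<in> {1..n}. M i) \<subseteq> R"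
        using IR unfolding assms(6) .
      from T.ex_power_series_multiplier[OF assms(2) finite_atLeastAtMost assms(5) this assms(7) f]
      show ?thesis using that by blast
    qed
    have hc: "h i \<in> carrier T" for i using h by auto
    have x: "h 0 \<otimes>\<^bsub>T\<^esub> b \<ominus>\<^bsub>T\<^esub> \<one>\<^bsub>T\<^esub> \<in> ?I"
      unfolding assms(6) using b hc by auto
    have "comaximal T (PIdl\<^bsub>T\<^esub> (h 0)) ?I"
      unfolding comaximal_def
    proof (intro equalityI subsetI)
      fix y assume "y \<in> PIdl\<^bsub>T\<^esub> h 0 <+>\<^bsub>T\<^esub> ?I"
      then show "y \<in> carrier T"
        using IR RE(1) hc unfolding set_add_def' cgenideal_def by auto
    next
      fix y assume y: "y \<in> carrier T"
      let ?x = "h 0 \<otimes>\<^bsub>T\<^esub> b \<ominus>\<^bsub>T\<^esub> \<one>\<^bsub>T\<^esub>"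
      have "?x \<otimes>\<^bsub>T\<^esub> (\<ominus>\<^bsub>T\<^esub> y) \<in> ?I"
        using x y hc b ideal.I_r_closed[OF maximalideal.axioms(1)[OF assms(5)]]
        unfolding assms(6) by auto
      moreover have "y \<otimes>\<^bsub>T\<^esub> b \<otimes>\<^bsub>T\<^esub> h 0 \<in> PIdl\<^bsub>T\<^esub> h 0"
        using y b unfolding cgenideal_def by blast
      moreover have "y = y \<otimes>\<^bsub>T\<^esub> b \<otimes>\<^bsub>T\<^esub> h 0 \<oplus>\<^bsub>T\<^esub> ?x \<otimes>\<^bsub>T\<^esub> (\<ominus>\<^bsub>T\<^esub> y)"
        using y b(1) hc[of 0] by algebra
      ultimately show "y \<in> PIdl\<^bsub>T\<^esub> h 0 <+>\<^bsub>T\<^esub> ?I"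
        unfolding set_add_def' by blast
    qed
    then obtain r u where r: "r \<in> R" and u: "u \<in> Units T" and hu: "h 0 = r \<otimes>\<^bsub>T\<^esub> u"
      and com: "comaximal (T\<lparr>carrier := R\<rparr>) (PIdl\<^bsub>T\<lparr>carrier := R\<rparr>\<^esub> r) ?I"
      using assms(4) hc[of 0] unfolding locally_associated_subring_def by blast
    have "\<one>\<^bsub>T\<^esub> \<in> PIdl\<^bsub>T\<lparr>carrier := R\<rparr>\<^esub> r <+>\<^bsub>T\<lparr>carrier := R\<rparr>\<^esub> ?I"
      using com RE(3) by (simp add: comaximal_def)
    then obtain s m where s: "s \<in> R" and m: "m \<in> ?I"
      and one: "\<one>\<^bsub>T\<^esub> = s \<otimes>\<^bsub>T\<^esub> r \<oplus>\<^bsub>T\<^esub> m"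
      unfolding set_add_def' cgenideal_def by auto
    have c: "r \<in> carrier T" "s \<in> carrier T" "m \<in> carrier T" "u \<in> carrier T"
      using r s m u IR RE(1) by auto
    \<comment> \<open>Multiplying \<open>h\<close> by \<open>s\<close> changes its constant term to \<open>s r u = u - m u\<close>; adding \<open>m u\<close>
      turns it into the unit \<open>u\<close>.\<close>
    define v where "v = (\<lambda>k. s \<otimes>\<^bsub>T\<^esub> h k \<oplus>\<^bsub>T\<^esub> (if k = 0 then m \<otimes>\<^bsub>T\<^esub> u else \<zero>\<^bsub>T\<^esub>))"
    have vc: "v \<in> UNIV \<rightarrow> carrier T" using c hc by (simp add: v_def)
    have "v 0 = (s \<otimes>\<^bsub>T\<^esub> r \<oplus>\<^bsub>T\<^esub> m) \<otimes>\<^bsub>T\<^esub> u"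
      unfolding v_def hu using c by (simp add: T.l_distr T.m_assoc)
    then have "v 0 = u" using c by (simp add: one[symmetric])
    then have "v \<in> Units ?P"
      using T.power_series_Units[OF vc] u by simp
    moreover have "(f \<otimes>\<^bsub>?P\<^esub> v) k \<in> R" for k
    proof -
      have fk: "f k \<in> carrier T" using f by auto
      have "(f \<otimes>\<^bsub>?P\<^esub> v) k = s \<otimes>\<^bsub>T\<^esub> (f \<otimes>\<^bsub>?P\<^esub> h) k \<oplus>\<^bsub>T\<^esub> f k \<otimes>\<^bsub>T\<^esub> (m \<otimes>\<^bsub>T\<^esub> u)"
        unfolding v_def using f h c hc
        by (subst T.power_series_mult_add_right)
          (auto simp: T.power_series_mult_smult_right T.power_series_mult_const_right
            simp del: power_series_ring_simps(2))
      moreover have "f k \<otimes>\<^bsub>T\<^esub> (m \<otimes>\<^bsub>T\<^esub> u) = m \<otimes>\<^bsub>T\<^esub> (u \<otimes>\<^bsub>T\<^esub> f k)"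
        using fk c by (simp add: T.m_ac)
      moreover have "\<dots> \<in> R" using I_mult[OF m] fk c by simp
      moreover have "(f \<otimes>\<^bsub>?P\<^esub> h) k \<in> R" using h(2) by blast
      ultimately show ?thesis using s RE(6,7) by (metis (no_types))
    qed
    ultimately show ?thesis by blast
  qed
  moreover have "carrier (power_series_ring (T\<lparr>carrier := R\<rparr>)) = UNIV \<rightarrow> R" by simp
  ultimately show ?thesis
    unfolding associated_subring_def
    using T.subring_power_series[OF assms(2)] by auto
qed

end
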